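(* Let $X:\mathbb R^n\times\mathbb R^k\to\mathbb R^n$ be smooth, let $M\subset\mathbb R^n$ be a regular (embedded) submanifold that is invariant under the flow of the control system $\dot x=X(x,u)$, and let $\tilde V:\mathbb R^n\to\mathbb R$ be a smooth non-negative function with $M=\tilde V^{-1}(0)$. Put $\tilde X(x,u)=X(x,u)-\nabla\tilde V(x)$. Let $(x_0,u_0)\in M\times\mathbb R^k$ satisfy $X(x_0,u_0)=0$. Suppose that a linear feedback controller $u:\mathbb R^n\to\mathbb R^k$, i.e. one of the form $u(x)=u_0+K(x-x_0)$ with $K\in\mathbb R^{k\times n}$, exponentially stabilizes the equilibrium point $x_0$ for the linearized system $$\dot x=\frac{\partial\tilde X}{\partial x}(x_0,u_0)(x-x_0)+\frac{\partial\tilde X}{\partial u}(x_0,u_0)(u-u_0),\qquad x\in\mathbb R^n .$$ Then the same controller (restricted to $M$) exponentially stabilizes the equilibrium point $x_0$ for the control system $\dot x=X(x,u)$, $x\in M$, on $M$.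
   Context: $M$ is invariant under the flow of $\dot x=X(x,u)$ means: for every control input, trajectories starting in $M$ stay in $M$, so that the system restricts to a control system on $M$. Since $\tilde V$ attains its minimum $0$ on $M$, $\nabla\tilde V=0$ on $M$, so $\dot x=\tilde X(x,u)$ and $\dot x=X(x,u)$ have the same restriction to $M$. A feedback $u(x)$ exponentially stabilizes an equilibrium $x_0$ of a control system if $x_0$ is a (locally) exponentially stable equilibrium of the closed-loop system: there are $C,c,\delta>0$ such that every closed-loop solution with $\|x(0)-x_0\|<\delta$ exists for all $t\ge0$ and satisfies $\|x(t)-x_0\|\le Ce^{-ct}\|x(0)-x_0\|$. For the system on $M$ the same is required for solutions with initial condition in $M$, with $\|\cdot\|$ the Euclidean norm of $\mathbb R^n$. Stability is understood locally throughout. *)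

theory Defs
  imports "HOL-Analysis.Analysis"
begin

text \<open>Only meant for open \<open>U\<close>, where \<open>frechet_derivative f (at x)\<close> depends on \<open>f\<close> near \<open>x \<in> U\<close> alone.
  In finite dimensions, continuity of all iterated directional derivatives is the usual \<open>C\<^sup>k\<close>.\<close>

primrec Ck_on :: "nat \<Rightarrow> 'a::euclidean_space set \<Rightarrow> ('a \<Rightarrow> 'b::euclidean_space) \<Rightarrow> bool" where
  "Ck_on 0 U f \<longleftrightarrow> continuous_on U f"
| "Ck_on (Suc k) U f \<longleftrightarrow> (\<forall>x\<in>U. f differentiable (at x)) \<and>
     (\<forall>v. Ck_on k U (\<lambda>x. frechet_derivative f (at x) v))"

definition smooth_on :: "'a::euclidean_space set \<Rightarrow> ('a \<Rightarrow> 'b::euclidean_space) \<Rightarrow> bool" where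
  "smooth_on U f \<longleftrightarrow> (\<forall>k. Ck_on k U f)"

text \<open>Around each point of \<open>M\<close> there is a chart of the ambient space straightening \<open>M\<close> to a
  \<open>d\<close>-dimensional linear subspace.\<close>

definition embedded_submanifold :: "nat \<Rightarrow> 'a::euclidean_space set \<Rightarrow> bool" where
  "embedded_submanifold d M \<longleftrightarrow>
     (\<forall>p\<in>M. \<exists>U W (\<phi> :: 'a \<Rightarrow> 'a) \<psi> S.
        open U \<and> p \<in> U \<and> open W \<and> homeomorphism U W \<phi> \<psi> \<and> smooth_on U \<phi> \<and> smooth_on W \<psi> \<and>
        subspace S \<and> dim S = d \<and> \<phi> ` (U \<inter> M) = W \<inter> S)"

definition grad :: "(real ^ 'n \<Rightarrow> real) \<Rightarrow> real ^ 'n \<Rightarrow> real ^ 'n" where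
  "grad f x = (\<chi> i. frechet_derivative f (at x) (axis i 1))"

text \<open>\<open>J\<close> may be open or closed on the right, unbounded, or just \<open>{0}\<close>; in the last case the
  differential equation is vacuous.\<close>

definition ode_solution ::
  "(real \<Rightarrow> 'a::euclidean_space \<Rightarrow> 'a) \<Rightarrow> real set \<Rightarrow> (real \<Rightarrow> 'a) \<Rightarrow> bool" where
  "ode_solution g J x \<longleftrightarrow> is_interval J \<and> 0 \<in> J \<and> J \<subseteq> {0..} \<and>
     (\<forall>t\<in>J. (x has_vector_derivative g t (x t)) (at t within J))"

text \<open>The control inputs are the continuous ones. Arbitrary functions of time are too many:
  \<open>x t = exp (- 1 / t)\<close>, \<open>x 0 = 0\<close> leaves \<open>{0}\<close> under \<open>x' = u x\<close> with \<open>u t = 1 / t\<^sup>2\<close>, \<open>u 0 = 0\<close>.\<close>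

definition control_invariant ::
  "('a::euclidean_space \<times> 'b::euclidean_space \<Rightarrow> 'a) \<Rightarrow> 'a set \<Rightarrow> bool" where
  "control_invariant f M \<longleftrightarrow>
     (\<forall>J u x. continuous_on J u \<and> ode_solution (\<lambda>t y. f (y, u t)) J x \<and> x 0 \<in> M
        \<longrightarrow> (\<forall>t\<in>J. x t \<in> M))"

text \<open>Local exponential stability of \<open>x' = g x\<close> on the state space \<open>S\<close>. That solutions exist for
  all \<open>t \<ge> 0\<close> is expressed by extending every solution on an interval \<open>J\<close> to \<open>{0..}\<close>;
  \<open>J = {0}\<close> yields a solution for every initial value.\<close>

definition exp_stable_on ::
  "('a::euclidean_space \<Rightarrow> 'a) \<Rightarrow> 'a set \<Rightarrow> 'a \<Rightarrow> bool" where
  "exp_stable_on g S x\<^sub>0 \<longleftrightarrow> x\<^sub>0 \<in> S \<and> g x\<^sub>0 = 0 \<and>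
     (\<exists>C>0. \<exists>c>0. \<exists>\<delta>>0. \<forall>J x.
        ode_solution (\<lambda>_. g) J x \<and> x 0 \<in> S \<and> norm (x 0 - x\<^sub>0) < \<delta> \<longrightarrow>
        (\<exists>y. ode_solution (\<lambda>_. g) {0..} y \<and> (\<forall>t\<in>J. y t = x t) \<and>
             (\<forall>t\<ge>0. y t \<in> S \<and> norm (y t - x\<^sub>0) \<le> C * exp (- c * t) * norm (x 0 - x\<^sub>0))))"

definition exp_stabilizes ::
  "('a \<Rightarrow> 'b) \<Rightarrow> ('a::euclidean_space \<times> 'b::euclidean_space \<Rightarrow> 'a) \<Rightarrow> 'a set \<Rightarrow> 'a \<Rightarrow> bool" where
  "exp_stabilizes u f S x\<^sub>0 \<longleftrightarrow> exp_stable_on (\<lambda>x. f (x, u x)) S x\<^sub>0"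

definition linearization ::
  "('a::euclidean_space \<times> 'b::euclidean_space \<Rightarrow> 'a) \<Rightarrow> 'a \<Rightarrow> 'b \<Rightarrow> 'a \<times> 'b \<Rightarrow> 'a" where
  "linearization f x\<^sub>0 u\<^sub>0 = (\<lambda>(x, u).
     frechet_derivative (\<lambda>y. f (y, u\<^sub>0)) (at x\<^sub>0) (x - x\<^sub>0) +
     frechet_derivative (\<lambda>v. f (x\<^sub>0, v)) (at u\<^sub>0) (u - u\<^sub>0))"

end

theory Submission
  imports Defs
begin

text \<open>On \<open>M\<close>, where \<open>V\<close> is minimal, the gradient of \<open>V\<close> vanishes. Hence the closed-loop fields
  \<open>F x = X (x, u x)\<close> and \<open>G x = X' (x, u x)\<close> agree on \<open>M\<close>, and because \<open>M\<close> is invariant, every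
  solution of \<open>F\<close> starting in \<open>M\<close> is also a solution of \<open>G\<close>. The derivative of \<open>G\<close> at \<open>x\<^sub>0\<close> is the
  closed loop of the linearization (\<open>closed_loop_has_derivative\<close>), which is exponentially stable by
  assumption. Thus the principle of linearized stability for \<open>G\<close> governs the solutions of \<open>F\<close> in \<open>M\<close>.
  The derivative of \<open>F\<close> itself may well be unstable in directions transversal to \<open>M\<close>.

  This is proved for an arbitrary invariant set in \<open>exp_stable_on_invariant_set\<close>, with neither matrix
  exponentials nor Lyapunov functions: over a fixed time \<open>T\<close> the linear solutions shrink by a definite
  factor, and the nonlinear solutions stay so close to them that they shrink too
  (\<open>contraction_from_linearization\<close>). Repeating this over successive intervals of length \<open>T\<close> gives
  the exponential decay. Existence for all times comes from \<open>lipschitz_ode_solution_exists\<close>, applied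
  to \<open>F\<close> cut off outside a ball, and every given solution coincides with the one so obtained by
  \<open>ode_solution_unique\<close>.\<close>

section \<open>Global solutions for Lipschitz fields\<close>

lemma integral_has_vector_derivative_atLeast:
  fixes g :: "real \<Rightarrow> 'a::euclidean_space"
  assumes "continuous_on {0..} g" "t \<ge> 0"
  shows "((\<lambda>u. integral {0..u} g) has_vector_derivative g t) (at t within {0..})"
proof -
  have "((\<lambda>u. integral {0..u} g) has_vector_derivative g t) (at t within {0..t+1})"
    using assms by (intro integral_has_vector_derivative continuous_on_subset[OF assms(1)]) auto
  moreover have "at t within {0..t+1} = at t within {0..}"
    using assms(2) by (intro at_within_nhd[where S="{t-1<..<t+1}"]) auto
  ultimately show ?thesis by simp
qed

text \<open>A function growing like \<open>exp (l * t)\<close> has a primitive that is smaller by the factor \<open>1 / l\<close>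
  relative to the same weight; large \<open>l\<close> turns the Picard operator into a contraction.\<close>

lemma weighted_integral_bound:
  fixes g :: "real \<Rightarrow> 'a::euclidean_space"
  assumes "continuous_on {0..t} g" "t \<ge> 0" "l > 0" "N \<ge> 0"
    and "\<And>s. s \<in> {0..t} \<Longrightarrow> norm (g s) \<le> N * exp (l * s)"
  shows "exp (- l * t) * norm (integral {0..t} g) \<le> N / l"
proof -
  have I: "((\<lambda>s. N * exp (l * s)) has_integral (N / l * exp (l * t) - N / l * exp (l * 0))) {0..t}"
    using assms(2,3)
    by (intro fundamental_theorem_of_calculus)
       (auto intro!: derivative_eq_intros simp flip: has_real_derivative_iff_has_vector_derivative)
  have "norm (integral {0..t} g) \<le> N / l * exp (l * t) - N / l * exp (l * 0)"
    using integral_norm_bound_integral[OF integrable_continuous_real[OF assms(1)] has_integral_integrable[OF I]]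
      assms(5) integral_unique[OF I] by auto
  also have "\<dots> \<le> N / l * exp (l * t)"
    using assms(3,4) by simp
  finally have "exp (- l * t) * norm (integral {0..t} g) \<le> exp (- l * t) * (N / l * exp (l * t))"
    by (intro mult_left_mono) auto
  also have "\<dots> = N / l"
    by (simp add: exp_minus)
  finally show ?thesis .
qed

text \<open>The Picard operator has a fixed point \<open>y\<close> with \<open>exp (- l * t) *\<^sub>R y t\<close> bounded: in the
  corresponding weighted supremum norm it has Lipschitz constant \<open>L / l \<le> 1 / 2\<close>. The weight yields
  the solution on the whole half-line at once, with no gluing of short-time solutions.\<close>

proposition lipschitz_ode_solution_exists:
  fixes F :: "'a::euclidean_space \<Rightarrow> 'a"
  assumes lip: "L-lipschitz_on UNIV F"
  obtains y where "y 0 = a" "ode_solution (\<lambda>_. F) {0..} y"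
proof -
  define l where "l = 2 * (L + 1)"
  have L: "L \<ge> 0" using lip by (rule lipschitz_on_nonneg)
  then have l: "l > 0" "L / l \<le> 1 / 2" by (auto simp: l_def field_simps)
  have contF: "continuous_on UNIV F" using lip by (rule lipschitz_on_continuous_on)
  have lipF: "norm (F x - F y) \<le> L * norm (x - y)" for x y
    using lipschitz_onD[OF lip, of x y] by (simp add: dist_norm)
  define g where "g = (\<lambda>(w::real \<Rightarrow>\<^sub>C 'a) s. F (exp (l * s) *\<^sub>R w s))"
  have contg: "continuous_on S (g w)" for S w
    unfolding g_def by (intro continuous_on_compose2[OF contF] continuous_intros) auto
  \<comment> \<open>The Picard operator in terms of the rescaled function \<open>w t = exp (- l * t) *\<^sub>R y t\<close>;
    \<open>max 0 t\<close> extends it to all real \<open>t\<close>, so that it acts on bounded continuous functions.\<close>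
  define P where "P = (\<lambda>w t. exp (- l * max 0 t) *\<^sub>R (a + integral {0..max 0 t} (g w)))"
  have cont_int: "continuous_on {0..} (\<lambda>u. integral {0..u} (g w))" for w
    using integral_has_vector_derivative_atLeast[OF contg]
    by (auto simp: continuous_on_eq_continuous_within intro: has_vector_derivative_continuous)
  have "P w \<in> bcontfun" for w
  proof (rule bcontfun_normI)
    show "continuous_on UNIV (P w)"
      unfolding P_def
      by (intro continuous_intros continuous_on_compose2[OF cont_int]) auto
  next
    fix t :: real
    define s where "s = max 0 t"
    define N where "N = norm (F 0) + L * norm w"
    have N: "norm (g w r) \<le> N * exp (l * r)" if "r \<ge> 0" for r
    proof -
      have "norm (g w r) \<le> norm (F 0) + norm (F (exp (l * r) *\<^sub>R w r) - F 0)"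
        unfolding g_def by (metis add.commute norm_triangle_sub)
      also have "\<dots> \<le> norm (F 0) * 1 + L * (exp (l * r) * norm (w r))"
        using lipF[of "exp (l * r) *\<^sub>R w r" 0] by simp
      also have "\<dots> \<le> norm (F 0) * exp (l * r) + L * (exp (l * r) * norm w)"
        using L l(1) that norm_bounded[of w r] by (intro add_mono mult_left_mono) auto
      finally show ?thesis by (simp add: N_def algebra_simps)
    qed
    have "exp (- l * s) * norm (integral {0..s} (g w)) \<le> N / l"
      using N L l by (intro weighted_integral_bound contg) (auto simp: s_def N_def)
    moreover have "exp (- l * s) * norm a \<le> 1 * norm a"
      using l by (intro mult_right_mono) (auto simp: s_def)
    moreover have "norm (P w t) \<le> exp (- l * s) * (norm a + norm (integral {0..s} (g w)))"
      unfolding P_def s_def by (auto intro!: norm_triangle_ineq)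
    ultimately show "norm (P w t) \<le> norm a + N / l"
      by (simp add: algebra_simps)
  qed
  then have PB: "apply_bcontfun (Bcontfun (P w)) = P w" for w
    by (rule Bcontfun_inverse)
  have contraction: "dist (Bcontfun (P v)) (Bcontfun (P w)) \<le> 1 / 2 * dist v w" for v w
  proof (rule dist_bound)
    fix t :: real
    define s where "s = max 0 t"
    have diff: "P v t - P w t = exp (- l * s) *\<^sub>R integral {0..s} (\<lambda>r. g v r - g w r)"
      unfolding P_def s_def
      by (subst integral_diff) (auto intro!: integrable_continuous_real contg simp: algebra_simps)
    have "norm (g v r - g w r) \<le> L * dist v w * exp (l * r)" for r
    proof -
      have "norm (g v r - g w r) \<le> L * norm (exp (l * r) *\<^sub>R v r - exp (l * r) *\<^sub>R w r)"
        unfolding g_def by (rule lipF)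
      also have "\<dots> = L * exp (l * r) * dist (v r) (w r)"
        by (simp add: dist_norm flip: scaleR_diff_right)
      also have "\<dots> \<le> L * exp (l * r) * dist v w"
        using L by (intro mult_left_mono dist_bounded) auto
      finally show ?thesis by (simp add: mult_ac)
    qed
    then have "exp (- l * s) * norm (integral {0..s} (\<lambda>r. g v r - g w r)) \<le> L * dist v w / l"
      using l L by (intro weighted_integral_bound continuous_intros contg) (auto simp: s_def)
    also have "\<dots> = L / l * dist v w" by simp
    also have "\<dots> \<le> 1 / 2 * dist v w" using l by (intro mult_right_mono) auto
    finally show "dist (Bcontfun (P v) t) (Bcontfun (P w) t) \<le> 1 / 2 * dist v w"
      by (simp add: PB dist_norm diff)
  qed
  obtain w where "Bcontfun (P w) = w"
    using banach_fix_type[of "1/2" "\<lambda>w. Bcontfun (P w)"] contraction by auto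
  then have w: "w t = P w t" for t by (metis PB)
  define y where "y = (\<lambda>t. exp (l * t) *\<^sub>R w t)"
  have y: "y t = a + integral {0..t} (\<lambda>s. F (y s))" if "t \<ge> 0" for t
    unfolding y_def w[of t] P_def using that
    by (simp add: g_def max_def exp_minus)
  have "(y has_vector_derivative F (y t)) (at t within {0..})" if "t \<in> {0..}" for t
  proof -
    have "continuous_on {0..} (\<lambda>s. F (y s))"
      using contg[of "{0..}" w] by (simp add: g_def y_def)
    then have "((\<lambda>u. a + integral {0..u} (\<lambda>s. F (y s))) has_vector_derivative F (y t)) (at t within {0..})"
      using that by (auto intro!: derivative_eq_intros integral_has_vector_derivative_atLeast)
    then show ?thesis
      by (rule has_vector_derivative_transform[OF that, rotated]) (use y in auto)
  qed
  then have "ode_solution (\<lambda>_. F) {0..} y"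
    by (auto simp: ode_solution_def is_interval_ci)
  moreover have "y 0 = a" using y[of 0] by simp
  ultimately show thesis using that by blast
qed

section \<open>Growth estimate and uniqueness of solutions\<close>

text \<open>The squared norm is differentiable where the norm need not be. By Cauchy-Schwarz and
  \<open>2 * norm (w t) * b \<le> (norm (w t))\<^sup>2 + b\<^sup>2\<close> its derivative is at most
  \<open>(2 * L + 1) * (norm (w t))\<^sup>2 + b\<^sup>2\<close>; this is the origin of the constants.\<close>

lemma gronwall_norm:
  fixes w :: "real \<Rightarrow> 'a::real_inner"
  assumes w: "\<And>t. t \<in> {0..T} \<Longrightarrow> (w has_vector_derivative w' t) (at t within {0..T})"
    and le: "\<And>t. t \<in> {0..T} \<Longrightarrow> norm (w' t) \<le> L * norm (w t) + b"
    and "T \<ge> 0" "L \<ge> 0"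
  shows "(norm (w T))\<^sup>2 \<le> exp ((2 * L + 1) * T) * ((norm (w 0))\<^sup>2 + b\<^sup>2 * T)"
proof -
  define m where "m = 2 * L + 1"
  define f where "f = (\<lambda>t. exp (- m * t) * (w t \<bullet> w t) - b\<^sup>2 * t)"
  have cont: "continuous_on {0..T} w"
    unfolding continuous_on_eq_continuous_within using w has_vector_derivative_continuous by blast
  have "f 0 \<ge> f T"
  proof (rule DERIV_nonpos_imp_decreasing_open[OF \<open>T \<ge> 0\<close>])
    fix t assume t: "0 < t" "t < T"
    have d: "(w has_derivative (\<lambda>h. h *\<^sub>R w' t)) (at t)"
      using w[of t] t by (simp add: at_within_Icc_at has_vector_derivative_def)
    have "(f has_real_derivative
        exp (- m * t) * (2 * (w t \<bullet> w' t)) - m * exp (- m * t) * (w t \<bullet> w t) - b\<^sup>2) (at t)"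
      unfolding f_def has_field_derivative_def
      by (rule derivative_eq_intros d refl)+
         (auto simp: fun_eq_iff algebra_simps inner_commute)
    moreover have "exp (- m * t) * (2 * (w t \<bullet> w' t)) - m * exp (- m * t) * (w t \<bullet> w t) - b\<^sup>2 \<le> 0"
    proof -
      have "2 * (w t \<bullet> w' t) \<le> 2 * (norm (w t) * norm (w' t))"
        using norm_cauchy_schwarz[of "w t" "w' t"] by simp
      also have "\<dots> \<le> 2 * (norm (w t) * (L * norm (w t) + b))"
        using le[of t] t by (intro mult_left_mono) auto
      also have "\<dots> \<le> m * (w t \<bullet> w t) + b\<^sup>2"
        using sum_squares_bound[of "norm (w t)" b]
        by (simp add: m_def power2_norm_eq_inner[symmetric] power2_eq_square algebra_simps)
      finally have "exp (- m * t) * (2 * (w t \<bullet> w' t)) \<le> exp (- m * t) * (m * (w t \<bullet> w t) + b\<^sup>2)"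
        by (intro mult_left_mono) auto
      moreover have "m * t \<ge> 0" using t \<open>L \<ge> 0\<close> by (simp add: m_def)
      then have "exp (- m * t) * b\<^sup>2 \<le> b\<^sup>2"
        by (intro mult_left_le_one_le) auto
      ultimately show ?thesis by (simp add: algebra_simps)
    qed
    ultimately show "\<exists>y. (f has_real_derivative y) (at t) \<and> y \<le> 0" by blast
  next
    show "continuous_on {0..T} f"
      unfolding f_def by (intro continuous_intros cont)
  qed
  then have "exp (m * T) * (exp (- m * T) * (w T \<bullet> w T)) \<le> exp (m * T) * (w 0 \<bullet> w 0 + b\<^sup>2 * T)"
    unfolding f_def by (intro mult_left_mono) auto
  moreover have "exp (m * T) * (exp (- m * T) * (w T \<bullet> w T)) = w T \<bullet> w T"
    by (simp add: exp_minus)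
  ultimately show ?thesis
    unfolding power2_norm_eq_inner m_def[symmetric] by linarith
qed

lemma ode_solution_Icc:
  assumes "ode_solution g J x" "T \<in> J"
  shows "{0..T} \<subseteq> J"
    and "t \<in> {0..T} \<Longrightarrow> (x has_vector_derivative g t (x t)) (at t within {0..T})"
proof -
  show sub: "{0..T} \<subseteq> J"
    using assms mem_is_interval_1_I[of J 0 T] by (auto simp: ode_solution_def)
  show "(x has_vector_derivative g t (x t)) (at t within {0..T})" if "t \<in> {0..T}"
  proof (rule has_vector_derivative_within_subset[OF _ sub])
    show "(x has_vector_derivative g t (x t)) (at t within J)"
      using assms(1) sub that by (auto simp: ode_solution_def)
  qed
qed

lemma ode_solution_continuous_on:
  assumes "ode_solution g J x"
  shows "continuous_on J x"
  unfolding continuous_on_eq_continuous_within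
  using assms has_vector_derivative_continuous unfolding ode_solution_def by blast

text \<open>Up to any fixed time both solutions stay in some ball, where the field is Lipschitz, so a local
  Lipschitz condition suffices.\<close>

lemma ode_solution_unique:
  fixes F :: "'a::euclidean_space \<Rightarrow> 'a"
  assumes lip: "\<And>r. \<exists>L. L-lipschitz_on (cball p r) F"
    and x: "ode_solution (\<lambda>_. F) I x" and y: "ode_solution (\<lambda>_. F) J y"
    and "x 0 = y 0" and t: "t \<in> I" "t \<in> J"
  shows "x t = y t"
proof -
  have "t \<ge> 0" using x t by (auto simp: ode_solution_def)
  have "compact (x ` {0..t} \<union> y ` {0..t})"
    using ode_solution_Icc(1)[OF x t(1)] ode_solution_Icc(1)[OF y t(2)]
    by (intro compact_Un compact_continuous_image)
       (auto intro: continuous_on_subset ode_solution_continuous_on[OF x] ode_solution_continuous_on[OF y])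
  then obtain r where r: "x ` {0..t} \<union> y ` {0..t} \<subseteq> cball p r"
    using compact_imp_bounded bounded_any_center[of _ p] by (metis mem_cball subsetI)
  obtain L where L: "L-lipschitz_on (cball p r) F" using lip by blast
  have "(norm (x t - y t))\<^sup>2 \<le> exp ((2 * L + 1) * t) * ((norm (x 0 - y 0))\<^sup>2 + 0\<^sup>2 * t)"
  proof (rule gronwall_norm[where w' = "\<lambda>s. F (x s) - F (y s)"])
    show "((\<lambda>s. x s - y s) has_vector_derivative F (x s) - F (y s)) (at s within {0..t})"
      if "s \<in> {0..t}" for s
      using ode_solution_Icc(2)[OF x t(1) that] ode_solution_Icc(2)[OF y t(2) that]
      by (rule has_vector_derivative_diff)
    show "norm (F (x s) - F (y s)) \<le> L * norm (x s - y s) + 0" if "s \<in> {0..t}" for s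
    proof -
      have "x s \<in> cball p r" "y s \<in> cball p r" using r that by blast+
      then show ?thesis using lipschitz_onD[OF L] by (simp add: dist_norm)
    qed
  qed (use \<open>t \<ge> 0\<close> lipschitz_on_nonneg[OF L] in auto)
  then show ?thesis using \<open>x 0 = y 0\<close> by simp
qed

lemma ode_solution_shift:
  assumes "ode_solution (\<lambda>_. F) {0..} x" "s \<ge> 0"
  shows "ode_solution (\<lambda>_. F) {0..} (\<lambda>t. x (t + s))"
proof -
  have "((\<lambda>t. x (t + s)) has_vector_derivative F (x (t + s))) (at t within {0..})" if "t \<ge> 0" for t
  proof -
    have "((x \<circ> (\<lambda>t. t + s)) has_vector_derivative 1 *\<^sub>R F (x (t + s))) (at t within {0..})"
    proof (rule vector_diff_chain_within)
      show "((\<lambda>t. t + s) has_vector_derivative 1) (at t within {0..})"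
        by (auto intro!: derivative_eq_intros)
      show "(x has_vector_derivative F (x (t + s))) (at (t + s) within (\<lambda>t. t + s) ` {0..})"
      proof (rule has_vector_derivative_within_subset)
        show "(x has_vector_derivative F (x (t + s))) (at (t + s) within {0..})"
          using assms that by (simp add: ode_solution_def)
      qed (use assms(2) in auto)
    qed
    then show ?thesis by (simp add: o_def)
  qed
  then show ?thesis by (auto simp: ode_solution_def is_interval_ci)
qed

section \<open>Linearized stability on an invariant set\<close>

text \<open>The linear solution with the same initial value shrinks by \<open>exp (- 1) / 2\<close> over a suitable time
  \<open>T\<close>. If the nonlinear solution \<open>z\<close> obeys an a priori bound with factor \<open>E\<close>, then near \<open>p\<close> the
  remainder of \<open>G\<close> along \<open>z\<close> is at most \<open>\<epsilon> * E * norm (z 0 - p)\<close>, so by Gronwall's inequality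
  the two solutions differ at time \<open>T\<close> by another \<open>exp (- 1) / 2\<close> at most. The time \<open>T\<close> is
  chosen before \<open>E\<close>, because the a priori bound itself depends on \<open>T\<close>.\<close>

lemma contraction_from_linearization:
  fixes G A :: "'a::euclidean_space \<Rightarrow> 'a"
  assumes G: "(G has_derivative A) (at p)" "G p = 0"
    and stab: "exp_stable_on (\<lambda>x. A (x - p)) UNIV p"
  obtains T where "T > 0"
    and "\<And>E. E > 0 \<Longrightarrow> \<exists>\<rho>>0. \<forall>z.
      (\<forall>t\<in>{0..T}. (z has_vector_derivative G (z t)) (at t within {0..T})) \<and> norm (z 0 - p) < \<rho> \<and>
      (\<forall>t\<in>{0..T}. norm (z t - p) \<le> E * norm (z 0 - p))
      \<longrightarrow> norm (z T - p) \<le> exp (- 1) * norm (z 0 - p)"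
proof -
  interpret A: bounded_linear A using G(1) by (rule has_derivative_bounded_linear)
  obtain C c \<delta> where C: "C > 0" "c > 0" "\<delta> > 0"
    and sol: "\<forall>J x. ode_solution (\<lambda>_ x. A (x - p)) J x \<and> x 0 \<in> UNIV \<and> norm (x 0 - p) < \<delta> \<longrightarrow>
      (\<exists>y. ode_solution (\<lambda>_ x. A (x - p)) {0..} y \<and> (\<forall>t\<in>J. y t = x t) \<and>
         (\<forall>t\<ge>0. y t \<in> UNIV \<and> norm (y t - p) \<le> C * exp (- c * t) * norm (x 0 - p)))"
    using stab unfolding exp_stable_on_def by (elim conjE exE) auto
  \<comment> \<open>Stability quantifies over extensions of given solutions; a constant function on \<open>{0}\<close> is a
    solution there and so yields one for every initial value.\<close>
  have lin: "\<exists>y. ode_solution (\<lambda>_ x. A (x - p)) {0..} y \<and> y 0 = a \<and>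
         (\<forall>t\<ge>0. norm (y t - p) \<le> C * exp (- c * t) * norm (a - p))" if "norm (a - p) < \<delta>" for a
  proof -
    have "ode_solution (\<lambda>_ x. A (x - p)) {0} (\<lambda>_. a)"
      unfolding ode_solution_def has_vector_derivative_def has_derivative_within_alt
      by (simp add: bounded_linear_scaleR_left gt_ex is_interval_1)
    then obtain y where "ode_solution (\<lambda>_ x. A (x - p)) {0..} y" "\<forall>t\<in>{0}. y t = a"
      "\<forall>t\<ge>0. y t \<in> UNIV \<and> norm (y t - p) \<le> C * exp (- c * t) * norm (a - p)"
      using sol[rule_format, of "{0}" "\<lambda>_. a"] \<open>norm (a - p) < \<delta>\<close> by blast
    then show ?thesis by auto
  qed
  define T where "T = (\<bar>ln (2 * C)\<bar> + 1) / c"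
  have T: "T > 0" using C by (auto simp: T_def)
  have "C * exp (- c * T) = C * exp (- \<bar>ln (2 * C)\<bar>) * exp (- 1)"
    using C by (simp add: T_def flip: exp_add)
  also have "\<dots> \<le> C * exp (- ln (2 * C)) * exp (- 1)"
    using C by (intro mult_right_mono mult_left_mono) auto
  also have "\<dots> = exp (- 1) / 2"
    using C by (simp add: exp_minus field_simps)
  finally have CT: "C * exp (- c * T) \<le> exp (- 1) / 2" .
  obtain LA where LA: "LA > 0" "\<And>h. norm (A h) \<le> LA * norm h"
    using A.pos_bounded by (metis mult.commute)
  define Q where "Q = sqrt (exp ((2 * LA + 1) * T) * T)"
  have Q: "Q > 0" "Q\<^sup>2 = exp ((2 * LA + 1) * T) * T" using T by (auto simp: Q_def)
  show thesis
  proof (rule that[OF T])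
    fix E :: real assume E: "E > 0"
    \<comment> \<open>\<open>Q\<^sup>2\<close> is the factor of \<open>b\<^sup>2\<close> in Gronwall's bound at time \<open>T\<close>; this makes the deviation
      \<open>Q * \<epsilon> * E\<close> equal to the admissible \<open>exp (- 1) / 2\<close>.\<close>
    define \<epsilon> where "\<epsilon> = exp (- 1) / 2 / (Q * E)"
    have \<epsilon>: "\<epsilon> > 0" "Q * (\<epsilon> * E) = exp (- 1) / 2" using Q E by (auto simp: \<epsilon>_def field_simps)
    obtain \<eta> where \<eta>: "\<eta> > 0"
      "\<And>y. norm (y - p) < \<eta> \<Longrightarrow> norm (G y - A (y - p)) \<le> \<epsilon> * norm (y - p)"
      using G \<epsilon>(1) unfolding has_derivative_at_alt by auto
    show "\<exists>\<rho>>0. \<forall>z.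
      (\<forall>t\<in>{0..T}. (z has_vector_derivative G (z t)) (at t within {0..T})) \<and> norm (z 0 - p) < \<rho> \<and>
      (\<forall>t\<in>{0..T}. norm (z t - p) \<le> E * norm (z 0 - p))
      \<longrightarrow> norm (z T - p) \<le> exp (- 1) * norm (z 0 - p)"
    proof (intro exI[of _ "min \<delta> (\<eta> / E)"] conjI allI impI; (elim conjE)?)
      show "min \<delta> (\<eta> / E) > 0" using C \<eta> E by simp
    next
      fix z
      assume z: "\<forall>t\<in>{0..T}. (z has_vector_derivative G (z t)) (at t within {0..T})"
        and small: "norm (z 0 - p) < min \<delta> (\<eta> / E)"
        and bound: "\<forall>t\<in>{0..T}. norm (z t - p) \<le> E * norm (z 0 - p)"
      define a where "a = norm (z 0 - p)"
      obtain y where y: "ode_solution (\<lambda>_ x. A (x - p)) {0..} y" "y 0 = z 0"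
        and decay: "\<And>t. t \<ge> 0 \<Longrightarrow> norm (y t - p) \<le> C * exp (- c * t) * a"
        using lin[of "z 0"] small by (auto simp: a_def)
      have "(norm (z T - y T))\<^sup>2 \<le>
          exp ((2 * LA + 1) * T) * ((norm (z 0 - y 0))\<^sup>2 + (\<epsilon> * E * a)\<^sup>2 * T)"
      proof (rule gronwall_norm[where w' = "\<lambda>t. G (z t) - A (y t - p)"])
        fix t assume t: "t \<in> {0..T}"
        show "((\<lambda>t. z t - y t) has_vector_derivative G (z t) - A (y t - p)) (at t within {0..T})"
          using z t ode_solution_Icc(2)[OF y(1), of T t] by (intro has_vector_derivative_diff) auto
        have zt: "norm (z t - p) \<le> E * a" using bound t by (auto simp: a_def)
        also have "E * a < \<eta>" using small E by (auto simp: a_def field_simps)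
        finally have "norm (G (z t) - A (z t - p)) \<le> \<epsilon> * norm (z t - p)" by (rule \<eta>(2))
        also have "\<dots> \<le> \<epsilon> * (E * a)" using zt \<epsilon> by (intro mult_left_mono) auto
        finally have "norm (G (z t) - A (z t - p)) \<le> \<epsilon> * E * a" by (simp add: mult_ac)
        moreover have "A (z t - p) - A (y t - p) = A (z t - y t)"
          by (simp flip: A.diff)
        moreover have "norm (G (z t) - A (y t - p)) \<le>
            norm (G (z t) - A (z t - p)) + norm (A (z t - p) - A (y t - p))"
          using norm_triangle_ineq[of "G (z t) - A (z t - p)" "A (z t - p) - A (y t - p)"] by simp
        ultimately show "norm (G (z t) - A (y t - p)) \<le> LA * norm (z t - y t) + \<epsilon> * E * a"
          using LA(2)[of "z t - y t"] by simp
      qed (use T LA in auto)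
      also have "\<dots> = (Q * (\<epsilon> * E) * a)\<^sup>2"
        by (simp add: y(2) Q(2) power_mult_distrib)
      finally have "norm (z T - y T) \<le> exp (- 1) / 2 * a"
        unfolding \<epsilon>(2) by (rule power2_le_imp_le) (simp add: a_def)
      moreover have "norm (y T - p) \<le> exp (- 1) / 2 * a"
        using decay[of T] T mult_right_mono[OF CT, of a] by (simp add: a_def)
      moreover have "norm (z T - p) \<le> norm (z T - y T) + norm (y T - p)"
        using norm_triangle_ineq[of "z T - y T" "y T - p"] by simp
      ultimately show "norm (z T - p) \<le> exp (- 1) * norm (z 0 - p)"
        by (simp add: a_def)
    qed
  qed
qed

text \<open>Solutions of \<open>F\<close> that start in \<open>M\<close> stay there and so are solutions of \<open>G\<close>, to which the
  contraction over time \<open>T\<close> applies; iterating it gives exponential decay. To have solutions on the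
  whole half-line before knowing that they stay near \<open>p\<close>, \<open>F\<close> is replaced by \<open>H\<close>, its composition
  with the projection to the unit ball \<open>B\<close>. As \<open>H\<close> is globally Lipschitz and vanishes at \<open>p\<close>, its
  solutions grow at most by the factor \<open>E\<close> during a time \<open>T\<close>. Hence those that start close to \<open>p\<close>
  remain in \<open>B\<close> for that time, where \<open>H = F\<close>; only then is invariance of \<open>M\<close> available.\<close>

theorem exp_stable_on_invariant_set:
  fixes F G A :: "'a::euclidean_space \<Rightarrow> 'a"
  assumes lip: "\<And>r. \<exists>L. L-lipschitz_on (cball p r) F"
    and p: "p \<in> M" "F p = 0"
    and inv: "\<And>J x t. ode_solution (\<lambda>_. F) J x \<Longrightarrow> x 0 \<in> M \<Longrightarrow> t \<in> J \<Longrightarrow> x t \<in> M"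
    and eq: "\<And>x. x \<in> M \<Longrightarrow> F x = G x"
    and G: "(G has_derivative A) (at p)"
    and stab: "exp_stable_on (\<lambda>x. A (x - p)) UNIV p"
  shows "exp_stable_on F M p"
proof -
  define B where "B = cball p 1"
  have B: "convex B" "closed B" "B \<noteq> {}" "p \<in> B" by (auto simp: B_def)
  obtain L where L: "L-lipschitz_on B F" using lip unfolding B_def by blast
  have "L \<ge> 0" using L by (rule lipschitz_on_nonneg)
  define H where "H = F \<circ> closest_point B"
  have "(L * 1)-lipschitz_on UNIV H"
    unfolding H_def
  proof (rule lipschitz_on_compose)
    show "1-lipschitz_on UNIV (closest_point B)"
      by (rule lipschitz_onI) (auto intro: closest_point_lipschitz[OF B(1-3)])
    show "L-lipschitz_on (range (closest_point B)) F"
      using L by (rule lipschitz_on_subset) (auto intro: closest_point_in_set[OF B(2,3)])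
  qed
  then have lipH: "L-lipschitz_on UNIV H" by simp
  have H_eq: "H x = F x" if "x \<in> B" for x using that by (simp add: H_def closest_point_self)
  have H_le: "norm (H x) \<le> L * norm (x - p)" for x
    using lipschitz_onD[OF lipH, of x p] H_eq[OF B(4)] p by (simp add: dist_norm)
  have Gp: "G p = 0" using eq[OF p(1)] p(2) by simp
  obtain T where T: "T > 0"
    and contr: "\<And>E. E > 0 \<Longrightarrow> \<exists>\<rho>>0. \<forall>z.
      (\<forall>t\<in>{0..T}. (z has_vector_derivative G (z t)) (at t within {0..T})) \<and> norm (z 0 - p) < \<rho> \<and>
      (\<forall>t\<in>{0..T}. norm (z t - p) \<le> E * norm (z 0 - p))
      \<longrightarrow> norm (z T - p) \<le> exp (- 1) * norm (z 0 - p)"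
    by (rule contraction_from_linearization[OF G Gp stab]) (rule that)
  define E where "E = exp ((L + 1) * T)"
  have E: "E > 0" by (simp add: E_def)
  obtain \<rho> where \<rho>: "\<rho> > 0" and contr_E:
    "\<And>z. (\<And>t. t \<in> {0..T} \<Longrightarrow> (z has_vector_derivative G (z t)) (at t within {0..T})) \<Longrightarrow>
      norm (z 0 - p) < \<rho> \<Longrightarrow> (\<And>t. t \<in> {0..T} \<Longrightarrow> norm (z t - p) \<le> E * norm (z 0 - p)) \<Longrightarrow>
      norm (z T - p) \<le> exp (- 1) * norm (z 0 - p)"
    using contr[OF E] by blast
  define \<delta> where "\<delta> = min \<rho> (1 / E)"
  have \<delta>: "\<delta> > 0" using \<rho> E by (simp add: \<delta>_def)

  have step: "(\<forall>t\<in>{0..T}. z t \<in> M \<inter> B \<and> norm (z t - p) \<le> E * norm (z 0 - p)) \<and>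
      norm (z T - p) \<le> exp (- 1) * norm (z 0 - p)"
    if z: "ode_solution (\<lambda>_. H) {0..} z" and zM: "z 0 \<in> M" and small: "norm (z 0 - p) < \<delta>" for z
  proof -
    have growth: "norm (z t - p) \<le> E * norm (z 0 - p)" if t: "t \<in> {0..T}" for t
    proof -
      have "(norm (z t - p))\<^sup>2 \<le> exp ((2 * L + 1) * t) * ((norm (z 0 - p))\<^sup>2 + 0\<^sup>2 * t)"
      proof (rule gronwall_norm)
        show "((\<lambda>s. z s - p) has_vector_derivative H (z s)) (at s within {0..t})"
          if "s \<in> {0..t}" for s
          using ode_solution_Icc(2)[OF z, of t s] that t
          by (auto intro!: derivative_eq_intros)
      qed (use H_le \<open>L \<ge> 0\<close> t in auto)
      also have "\<dots> = exp ((2 * L + 1) * t) * (norm (z 0 - p))\<^sup>2" by simp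
      also have "\<dots> \<le> exp (2 * ((L + 1) * T)) * (norm (z 0 - p))\<^sup>2"
      proof (intro mult_right_mono)
        have "(2 * L + 1) * t \<le> (2 * L + 2) * T"
          using t \<open>L \<ge> 0\<close> by (intro mult_mono) auto
        then show "exp ((2 * L + 1) * t) \<le> exp (2 * ((L + 1) * T))"
          by (simp add: algebra_simps)
      qed auto
      also have "\<dots> = (E * norm (z 0 - p))\<^sup>2"
        by (simp add: E_def power_mult_distrib flip: exp_double)
      finally show ?thesis
        by (rule power2_le_imp_le) (simp add: E_def)
    qed
    have "E * norm (z 0 - p) \<le> 1"
      using small E by (auto simp: \<delta>_def field_simps)
    with growth have inB: "z t \<in> B" if "t \<in> {0..T}" for t
      using that by (force simp: B_def dist_norm norm_minus_commute)
    have "ode_solution (\<lambda>_. F) {0..T} z"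
      using ode_solution_Icc(2)[OF z, of T] T H_eq[OF inB] unfolding ode_solution_def
      by (auto simp: is_interval_cc)
    then have inM: "z t \<in> M" if "t \<in> {0..T}" for t using inv zM that by blast
    have "norm (z T - p) \<le> exp (- 1) * norm (z 0 - p)"
    proof (rule contr_E)
      show "(z has_vector_derivative G (z t)) (at t within {0..T})" if "t \<in> {0..T}" for t
        using ode_solution_Icc(2)[OF z, of T t] that T H_eq[OF inB] eq[OF inM] by auto
    qed (use small growth in \<open>auto simp: \<delta>_def\<close>)
    with growth inB inM show ?thesis by blast
  qed

  have global: "z t \<in> M \<inter> B \<and> norm (z t - p) \<le> (E * exp 1) * exp (- (1 / T) * t) * norm (z 0 - p)"
    if z: "ode_solution (\<lambda>_. H) {0..} z" and zM: "z 0 \<in> M" and small: "norm (z 0 - p) < \<delta>" and "t \<ge> 0"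
    for z t
  proof -
    have k: "z (real k * T) \<in> M \<and> norm (z (real k * T) - p) \<le> exp (- real k) * norm (z 0 - p)" for k
    proof (induction k)
      case (Suc k)
      have "exp (- real k) * norm (z 0 - p) \<le> 1 * norm (z 0 - p)"
        by (intro mult_right_mono) auto
      then have "norm (z (real k * T) - p) < \<delta>" using Suc small by linarith
      with step[OF ode_solution_shift[OF z, of "real k * T"]] Suc T
      have "z (T + real k * T) \<in> M"
        and *: "norm (z (T + real k * T) - p) \<le> exp (- 1) * norm (z (real k * T) - p)"
        by auto
      note *
      also have "\<dots> \<le> exp (- 1) * (exp (- real k) * norm (z 0 - p))"
        using Suc by (intro mult_left_mono) auto
      also have "\<dots> = exp (- real (Suc k)) * norm (z 0 - p)"
        by (simp add: exp_diff exp_minus field_simps exp_add)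
      finally show ?case using \<open>z (T + real k * T) \<in> M\<close> by (simp add: algebra_simps)
    qed (use zM in simp)
    \<comment> \<open>Split \<open>t\<close> into full periods and a rest in \<open>{0..T}\<close>; the rest costs the factors \<open>E\<close>
      and \<open>exp 1\<close>.\<close>
    define k where "k = nat \<lfloor>t / T\<rfloor>"
    have kt: "real k \<le> t / T" "t / T < real k + 1"
      using \<open>t \<ge> 0\<close> T by (auto simp: k_def)
    define s where "s = t - real k * T"
    have s: "s \<in> {0..T}" using kt T by (auto simp: s_def field_simps)
    have "exp (- real k) * norm (z 0 - p) \<le> 1 * norm (z 0 - p)"
      by (intro mult_right_mono) auto
    then have "norm (z (real k * T) - p) < \<delta>" using k[of k] small by linarith
    with step[OF ode_solution_shift[OF z, of "real k * T"]] k[of k] T s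
    have "z (s + real k * T) \<in> M \<inter> B \<and>
        norm (z (s + real k * T) - p) \<le> E * norm (z (real k * T) - p)"
      by auto
    then have "z t \<in> M \<inter> B" and *: "norm (z t - p) \<le> E * norm (z (real k * T) - p)"
      by (simp_all add: s_def)
    note *
    also have "\<dots> \<le> E * (exp (- real k) * norm (z 0 - p))"
      using k[of k] E by (intro mult_left_mono) auto
    also have "\<dots> \<le> E * (exp (1 - t / T) * norm (z 0 - p))"
      using kt E by (intro mult_left_mono mult_right_mono) auto
    also have "exp (1 - t / T) = exp 1 * exp (- (1 / T) * t)" by (simp flip: exp_add)
    finally show ?thesis using \<open>z t \<in> M \<inter> B\<close> by (simp only: mult.assoc simp_thms)
  qed

  have "\<exists>y. ode_solution (\<lambda>_. F) {0..} y \<and> (\<forall>t\<in>J. y t = x t) \<and>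
      (\<forall>t\<ge>0. y t \<in> M \<and> norm (y t - p) \<le> (E * exp 1) * exp (- (1 / T) * t) * norm (x 0 - p))"
    if x: "ode_solution (\<lambda>_. F) J x" and x0: "x 0 \<in> M" "norm (x 0 - p) < \<delta>" for J x
  proof -
    obtain y where y: "y 0 = x 0" "ode_solution (\<lambda>_. H) {0..} y"
      using lipschitz_ode_solution_exists[OF lipH] by blast
    have y': "y t \<in> M \<inter> B \<and> norm (y t - p) \<le> (E * exp 1) * exp (- (1 / T) * t) * norm (x 0 - p)"
      if "t \<ge> 0" for t
      using global[OF y(2) _ _ that] x0 y(1) by simp
    have yF: "ode_solution (\<lambda>_. F) {0..} y"
      using y(2) y' H_eq by (auto simp: ode_solution_def)
    moreover have "\<forall>t\<in>J. y t = x t"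
    proof
      fix t assume t: "t \<in> J"
      moreover have "t \<in> {0..}" using t x by (auto simp: ode_solution_def)
      ultimately show "y t = x t"
        using ode_solution_unique[OF lip yF x y(1)] by blast
    qed
    ultimately show ?thesis using y' by blast
  qed
  moreover have "E * exp 1 > 0" "1 / T > 0" using E T by auto
  ultimately show ?thesis
    unfolding exp_stable_on_def using p \<delta> by blast
qed

section \<open>Smooth fields, gradients and the closed loop\<close>

lemma C1_lipschitz_on:
  fixes f :: "'a::euclidean_space \<Rightarrow> 'b::euclidean_space"
  assumes "Ck_on (Suc 0) UNIV f" "compact S" "convex S"
  shows "\<exists>L. L-lipschitz_on S f"
proof -
  have "\<exists>B. \<forall>x\<in>S. norm (frechet_derivative f (at x) i) \<le> B" for i
  proof -
    have "continuous_on S (\<lambda>x. frechet_derivative f (at x) i)"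
      using assms(1) by (auto intro: continuous_on_subset)
    then have "bounded ((\<lambda>x. frechet_derivative f (at x) i) ` S)"
      using assms(2) by (intro compact_imp_bounded compact_continuous_image)
    then show ?thesis by (auto simp: bounded_iff)
  qed
  then obtain B where B: "\<And>x i. x \<in> S \<Longrightarrow> norm (frechet_derivative f (at x) i) \<le> B i"
    by metis
  have der: "(f has_derivative frechet_derivative f (at x)) (at x)" for x
    using assms(1) by (auto simp: frechet_derivative_works)
  have "onorm (frechet_derivative f (at x)) \<le> (\<Sum>i\<in>Basis. B i)" if "x \<in> S" for x
    using onorm_componentwise[OF has_derivative_bounded_linear[OF der[of x]]] sum_mono[of Basis, OF B[OF that]]
    by (rule order_trans)
  then have "norm (f x - f y) \<le> (\<Sum>i\<in>Basis. B i) * norm (x - y)" if "x \<in> S" "y \<in> S" for x y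
    using der that by (intro differentiable_bound[OF assms(3)]) (auto intro: has_derivative_at_withinI)
  then have "norm (f x - f y) \<le> \<bar>\<Sum>i\<in>Basis. B i\<bar> * norm (x - y)" if "x \<in> S" "y \<in> S" for x y
    using that by (meson abs_ge_self mult_right_mono norm_ge_zero order_trans)
  then have "\<bar>\<Sum>i\<in>Basis. B i\<bar>-lipschitz_on S f"
    by (intro lipschitz_onI) (auto simp: dist_norm)
  then show ?thesis ..
qed

lemma grad_differentiable:
  assumes "Ck_on (Suc (Suc 0)) UNIV V"
  shows "grad V differentiable (at x)"
proof -
  have "(\<lambda>y. grad V y \<bullet> b) differentiable (at x)" if "b \<in> Basis" for b
    using assms that by (auto simp: grad_def Basis_vec_def inner_axis)
  then show ?thesis
    using differentiable_componentwise_within[of "grad V" x UNIV] by blast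
qed

lemma grad_minimum_eq_0:
  assumes "V differentiable (at x)" "\<And>y. V x \<le> V y"
  shows "grad V x = 0"
proof -
  have "(V has_derivative frechet_derivative V (at x)) (at x)"
    using assms(1) by (simp add: frechet_derivative_works)
  then have "frechet_derivative V (at x) = (\<lambda>h. 0)"
    by (rule has_derivative_local_min) (use assms(2) in simp)
  then show ?thesis by (simp add: grad_def vec_eq_iff)
qed

text \<open>Linearizing and closing the loop with an affine feedback commute: the two partial derivatives
  that make up the linearization add up to the derivative of \<open>f\<close> in the direction \<open>(h, K h)\<close>,
  which is the chain rule for the closed loop.\<close>

lemma closed_loop_has_derivative:
  fixes f :: "'a::euclidean_space \<times> 'b::euclidean_space \<Rightarrow> 'a"
  assumes f: "f differentiable (at (p, v))"
    and K: "bounded_linear K" and u: "u = (\<lambda>x. v + K (x - p))"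
  shows "((\<lambda>x. f (x, u x)) has_derivative (\<lambda>h. linearization f p v (p + h, u (p + h)))) (at p)"
proof -
  define D where "D = frechet_derivative f (at (p, v))"
  have D: "(f has_derivative D) (at (p, v))" using f by (simp add: D_def frechet_derivative_works)
  interpret D: bounded_linear D using D by (rule has_derivative_bounded_linear)
  interpret K: bounded_linear K by (rule K)
  have "((\<lambda>y. f (y, v)) has_derivative (\<lambda>h. D (h, 0))) (at p)"
    by (rule has_derivative_compose[of "\<lambda>y. (y, v)" _ p UNIV f D, OF _ D[simplified]])
       (auto intro!: derivative_eq_intros)
  then have 1: "frechet_derivative (\<lambda>y. f (y, v)) (at p) = (\<lambda>h. D (h, 0))"
    by (rule frechet_derivative_at[symmetric])
  have "((\<lambda>w. f (p, w)) has_derivative (\<lambda>h. D (0, h))) (at v)"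
    by (rule has_derivative_compose[of "\<lambda>w. (p, w)" _ v UNIV f D, OF _ D[simplified]])
       (auto intro!: derivative_eq_intros)
  then have 2: "frechet_derivative (\<lambda>w. f (p, w)) (at v) = (\<lambda>h. D (0, h))"
    by (rule frechet_derivative_at[symmetric])
  have "(\<lambda>h. linearization f p v (p + h, u (p + h))) = (\<lambda>h. D (h, K h))"
    by (auto simp: linearization_def 1 2 u simp flip: D.add)
  moreover have "((\<lambda>x. f (x, u x)) has_derivative (\<lambda>h. D (h, K h))) (at p)"
  proof (rule has_derivative_compose[of "\<lambda>x. (x, u x)" _ p UNIV f D])
    show "((\<lambda>x. (x, u x)) has_derivative (\<lambda>h. (h, K h))) (at p)"
      unfolding u by (auto intro!: derivative_eq_intros K.has_derivative)
    show "(f has_derivative D) (at (p, u p))" using D by (simp add: u K.zero)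
  qed
  ultimately show ?thesis by simp
qed

theorem mainTheorem1:
  fixes X X' :: "(real ^ 'n) \<times> (real ^ 'k) \<Rightarrow> real ^ 'n"
    and M :: "(real ^ 'n) set" and d :: nat
    and V :: "real ^ 'n \<Rightarrow> real"
    and x\<^sub>0 :: "real ^ 'n" and u\<^sub>0 :: "real ^ 'k"
    and u :: "real ^ 'n \<Rightarrow> real ^ 'k" and K :: "real ^ 'n ^ 'k"
  assumes "smooth_on UNIV X"
    and "embedded_submanifold d M"
    and "control_invariant X M"
    and "smooth_on UNIV V"
    and "\<And>x. V x \<ge> 0"
    and "M = V -` {0}"
    and "X' = (\<lambda>(x, v). X (x, v) - grad V x)"
    and "x\<^sub>0 \<in> M"
    and "X (x\<^sub>0, u\<^sub>0) = 0"
    and "u = (\<lambda>x. u\<^sub>0 + K *v (x - x\<^sub>0))"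
    and "exp_stabilizes u (linearization X' x\<^sub>0 u\<^sub>0) UNIV x\<^sub>0"
  shows "exp_stabilizes u X M x\<^sub>0"
proof -
  have X_C1: "Ck_on (Suc 0) UNIV X" and V_C2: "Ck_on (Suc (Suc 0)) UNIV V"
    using assms(1,4) by (auto simp only: smooth_on_def)
  have X_diff: "X differentiable (at z)" for z using X_C1 by (cases z) simp
  have K: "bounded_linear ((*v) K)" by (rule matrix_vector_mul_bounded_linear)
  have contu: "continuous_on S u" for S
    unfolding assms(10)
    by (intro continuous_intros bounded_linear.continuous_on[OF K])
  define F where "F = (\<lambda>x. X (x, u x))"
  define G where "G = (\<lambda>x. X' (x, u x))"
  define A where "A = (\<lambda>h. linearization X' x\<^sub>0 u\<^sub>0 (x\<^sub>0 + h, u (x\<^sub>0 + h)))"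

  have "exp_stable_on F M x\<^sub>0"
  proof (rule exp_stable_on_invariant_set)
    show "\<exists>L. L-lipschitz_on (cball x\<^sub>0 r) F" for r
    proof -
      obtain B where B: "B > 0" "\<And>h. norm (K *v h) \<le> norm h * B"
        using bounded_linear.pos_bounded[OF K] by blast
      have lipu: "B-lipschitz_on S u" for S
        using B by (intro lipschitz_onI)
          (auto simp: assms(10) dist_norm mult.commute simp flip: matrix_vector_mult_diff_distrib)
      have "compact (u ` cball x\<^sub>0 r)"
        by (intro compact_continuous_image contu) auto
      then obtain R where R: "u ` cball x\<^sub>0 r \<subseteq> cball 0 R"
        using compact_imp_bounded bounded_any_center[of _ 0] by (metis mem_cball subsetI)
      obtain L where L: "L-lipschitz_on (cball x\<^sub>0 r \<times> cball 0 R) X"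
        using C1_lipschitz_on[OF X_C1, of "cball x\<^sub>0 r \<times> cball 0 R"]
        by (metis compact_Times convex_Times compact_cball convex_cball)
      have "(L * sqrt (1\<^sup>2 + B\<^sup>2))-lipschitz_on (cball x\<^sub>0 r) (X \<circ> (\<lambda>x. (x, u x)))"
      proof (rule lipschitz_on_compose)
        show "(sqrt (1\<^sup>2 + B\<^sup>2))-lipschitz_on (cball x\<^sub>0 r) (\<lambda>x. (x, u x))"
          by (intro lipschitz_on_Pair lipschitz_on_id lipu)
        show "L-lipschitz_on ((\<lambda>x. (x, u x)) ` cball x\<^sub>0 r) X"
          using L by (rule lipschitz_on_subset) (use R in auto)
      qed
      then show ?thesis by (auto simp: F_def o_def)
    qed
    show "x\<^sub>0 \<in> M" by fact
    show "F x\<^sub>0 = 0" using assms(9) by (simp add: F_def assms(10))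
    \<comment> \<open>A closed-loop solution \<open>x\<close> is an open-loop solution for the continuous input \<open>u \<circ> x\<close>.\<close>
    show "x t \<in> M" if "ode_solution (\<lambda>_. F) J x" "x 0 \<in> M" "t \<in> J" for J x t
    proof -
      have "continuous_on J (\<lambda>t. u (x t))"
        using ode_solution_continuous_on[OF that(1)]
        by (intro continuous_on_compose2[OF contu[of UNIV]]) auto
      moreover have "ode_solution (\<lambda>t y. X (y, u (x t))) J x"
        using that(1) by (simp add: ode_solution_def F_def)
      ultimately show ?thesis
        using assms(3) that(2,3) unfolding control_invariant_def by blast
    qed
    show "F x = G x" if "x \<in> M" for x
    proof -
      have "grad V x = 0"
        using V_C2 assms(5,6) that by (intro grad_minimum_eq_0) auto
      then show ?thesis by (simp add: F_def G_def assms(7))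
    qed
    have "X' = (\<lambda>z. X z - grad V (fst z))" by (auto simp: assms(7))
    moreover have "(\<lambda>z. grad V (fst z)) differentiable (at (x\<^sub>0, u\<^sub>0))"
      using differentiable_chain_at[of fst "(x\<^sub>0, u\<^sub>0)" "grad V"] grad_differentiable[OF V_C2]
      by (auto simp: o_def intro: bounded_linear_imp_differentiable bounded_linear_fst)
    ultimately have "X' differentiable (at (x\<^sub>0, u\<^sub>0))"
      using X_diff by (auto intro: differentiable_diff)
    then show "(G has_derivative A) (at x\<^sub>0)"
      unfolding G_def A_def by (rule closed_loop_has_derivative[OF _ K assms(10)])
    show "exp_stable_on (\<lambda>x. A (x - x\<^sub>0)) UNIV x\<^sub>0"
      using assms(11) by (simp add: exp_stabilizes_def A_def)
  qed
  then show ?thesis by (simp add: exp_stabilizes_def F_def)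
qed

end
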